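(* Let $k$ be a positive integer. The maximum possible value of $n$ for which some simple connected graph of metric dimension at most $k$ contains the complete graph $K_{n}$ as a subgraph is $n = 2^{k}$.
   Context: All graphs are simple and connected. For vertices $u,v$ of a graph $G$, $d(u,v)$ is their distance in $G$. A set $S\subset V(G)$ is a resolving set for the vertices of $G$ if no two distinct vertices $u,v\in V(G)$ satisfy $d(u,s)=d(v,s)$ for all $s\in S$. The metric dimension $\dim(G)$ is the minimum size of a resolving set for the vertices of $G$. Subgraphs are not required to be induced. *)

theory Defs
  imports
    "Graph_Theory.Graph_Theory"
    "HOL-Library.Extended_Nat"
    "HOL-Library.Infinite_Typeclass"
begin

text \<open>
  Simple graphs are represented as symmetric loop-free digraphs without parallel arcs
  (an edge uv is the pair of arcs (u,v), (v,u)). The locale \<open>pair_bidirected_digraph\<close> says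
  exactly this and, unlike \<open>pair_graph\<close>, does not require finiteness. The library's
  \<open>connected\<close> includes having at least one vertex.
\<close>

definition simple_connected_graph :: "'a pair_pre_digraph \<Rightarrow> bool" where
  "simple_connected_graph G \<longleftrightarrow>
     pair_bidirected_digraph G \<and> Digraph_Component.connected (with_proj G)"

text \<open>
  The distance is the library's shortest-path cost for unit arc weights, i.e. the least
  number of arcs of a walk from u to v.
\<close>

definition graph_dist :: "'a pair_pre_digraph \<Rightarrow> 'a \<Rightarrow> 'a \<Rightarrow> ereal" where
  "graph_dist G u v = wf_digraph.\<mu> (with_proj G) (\<lambda>_. 1) u v"

definition resolving_set :: "'a pair_pre_digraph \<Rightarrow> 'a set \<Rightarrow> bool" where
  "resolving_set G S \<longleftrightarrow>
     S \<subseteq> pverts G \<and>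
     \<not> (\<exists>u \<in> pverts G. \<exists>v \<in> pverts G. u \<noteq> v \<and>
          (\<forall>s \<in> S. graph_dist G u s = graph_dist G v s))"

text \<open>
  Extended-natural valued, since an infinite graph may have no finite resolving set, in which
  case the infimum is infinite. Otherwise the infimum is attained, \<open>enat\<close> being well-ordered.
\<close>

definition metric_dim :: "'a pair_pre_digraph \<Rightarrow> enat" where
  "metric_dim G = (INF S \<in> {S. resolving_set G S \<and> finite S}. enat (card S))"

definition contains_complete :: "'a pair_pre_digraph \<Rightarrow> nat \<Rightarrow> bool" where
  "contains_complete G n \<longleftrightarrow>
     (\<exists>H :: 'a pair_pre_digraph.
        subgraph (with_proj H) (with_proj G) \<and> complete_digraph n (with_proj H))"

definition is_maximum :: "nat set \<Rightarrow> nat \<Rightarrow> bool" where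
  "is_maximum A m \<longleftrightarrow> m \<in> A \<and> (\<forall>n \<in> A. n \<le> m)"

end

theory Submission
  imports Defs
begin

text \<open>
  The bound comes from the fact that the distances from two adjacent vertices to a third differ by
  at most one. On the vertex set of a complete subgraph, the distance to a landmark \<open>s\<close> therefore
  takes at most two values, the least one \<open>m s\<close> and \<open>m s + 1\<close>. A vertex of the complete subgraph is thus
  described by the set of those landmarks that it is nearest to among the vertices of the complete
  subgraph, and as the landmarks resolve the graph, different vertices have different such sets.
  Hence there are at most \<open>2 ^ k\<close> of them (\<open>complete_subgraph_size_le\<close>).

  For the converse, a clique \<open>C\<close> is indexed by all subsets of a \<open>k\<close>-element set \<open>S\<close> of new vertices,
  and each vertex of \<open>C\<close> is joined to the elements of its subset. The vertex with subset \<open>S\<close> is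
  adjacent to all others, so the graph is connected. It is resolved by \<open>S\<close> because already the
  adjacencies to \<open>S\<close> tell the vertices of \<open>C\<close> apart, and an element of \<open>S\<close> is the only vertex at
  distance 0 from itself (\<open>resolving_set_if_neighbours_distinct\<close>). The graph is finite, so it
  serves both parts of the theorem, and any infinite type has room for it.
\<close>

section \<open>Distances in connected graphs\<close>

lemma simple_connected_graph_strongly_connected:
  assumes "simple_connected_graph G"
  shows "strongly_connected (with_proj G)"
proof -
  interpret pair_bidirected_digraph G
    using assms by (simp add: simple_connected_graph_def)
  show ?thesis
    using assms symmetric_connected_imp_strongly_connected[OF pair_sym_arcs]
    by (simp add: simple_connected_graph_def)
qed

lemma (in wf_digraph) awalk_cost_unit: "awalk_cost (\<lambda>_. 1) p = real (length p)"
  by (induct p) auto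

text \<open>
  Walk lengths are natural numbers, so the infimum that defines the distance is a minimum even
  though the graph may be infinite.
\<close>

lemma graph_dist_shortest_walk:
  assumes G: "simple_connected_graph G" and u: "u \<in> pverts G" and v: "v \<in> pverts G"
  obtains p where "pre_digraph.awalk (with_proj G) u p v"
    and "graph_dist G u v = ereal (real (length p))"
    and "\<And>q. pre_digraph.awalk (with_proj G) u q v \<Longrightarrow> length p \<le> length q"
proof -
  interpret pair_bidirected_digraph G
    using G by (simp add: simple_connected_graph_def)
  have "u \<rightarrow>\<^sup>*\<^bsub>with_proj G\<^esub> v"
    using simple_connected_graph_strongly_connected[OF G] u v
    by (auto simp: strongly_connected_def)
  then have "\<exists>p. awalk u p v"
    by (simp add: reachable_awalk)
  then obtain p where p: "awalk u p v" and min: "\<And>q. awalk u q v \<Longrightarrow> length p \<le> length q"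
    using ex_has_least_nat[of "\<lambda>p. awalk u p v" _ length] by blast
  have "graph_dist G u v = ereal (real (length p))"
    unfolding graph_dist_def \<mu>_def awalk_cost_unit
    by (rule antisym) (auto intro!: INF_lower2[of p] INF_greatest p min)
  with p min that show thesis by blast
qed

text \<open>
  A copy of the distance in the natural numbers, where a strict inequality is worth a whole step. It
  is meaningful only between vertices joined by a walk.
\<close>

definition hops :: "'a pair_pre_digraph \<Rightarrow> 'a \<Rightarrow> 'a \<Rightarrow> nat" where
  "hops G u v = (LEAST n. graph_dist G u v = ereal (real n))"

lemma graph_dist_eq_hops:
  assumes "simple_connected_graph G" "u \<in> pverts G" "v \<in> pverts G"
  shows "graph_dist G u v = ereal (real (hops G u v))"
  unfolding hops_def by (rule LeastI_ex) (metis graph_dist_shortest_walk[OF assms])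

text \<open>
  A shortest walk from \<open>v\<close> can be prolonged by the arc from \<open>u\<close> to \<open>v\<close>.
\<close>

lemma hops_le_Suc_adjacent:
  assumes G: "simple_connected_graph G" and uv: "(u, v) \<in> parcs G" and s: "s \<in> pverts G"
  shows "hops G u s \<le> Suc (hops G v s)"
proof -
  interpret pair_bidirected_digraph G
    using G by (simp add: simple_connected_graph_def)
  have u: "u \<in> pverts G" and v: "v \<in> pverts G"
    using uv by (auto dest: wellformed')
  obtain p where p: "awalk v p s" "graph_dist G v s = ereal (real (length p))"
    using graph_dist_shortest_walk[OF G v s] by blast
  obtain q where q: "awalk u q s" "graph_dist G u s = ereal (real (length q))"
      "\<And>r. awalk u r s \<Longrightarrow> length q \<le> length r"
    using graph_dist_shortest_walk[OF G u s] by blast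
  have "awalk u ((u, v) # p) s"
    using p(1) uv u by (simp add: awalk_Cons_iff)
  from q(3)[OF this] show ?thesis
    using p(2) q(2) graph_dist_eq_hops[OF G u s] graph_dist_eq_hops[OF G v s] by simp
qed

lemma graph_dist_eq_0_iff:
  assumes G: "simple_connected_graph G" and u: "u \<in> pverts G" and v: "v \<in> pverts G"
  shows "graph_dist G u v = 0 \<longleftrightarrow> u = v"
proof -
  interpret pair_bidirected_digraph G
    using G by (simp add: simple_connected_graph_def)
  obtain p where p: "awalk u p v" "graph_dist G u v = ereal (real (length p))"
      "\<And>q. awalk u q v \<Longrightarrow> length p \<le> length q"
    using graph_dist_shortest_walk[OF G u v] by blast
  show ?thesis
  proof
    assume "graph_dist G u v = 0"
    then show "u = v"
      using p(1,2) by (simp add: awalk_Nil_iff)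
  next
    assume "u = v"
    then show "graph_dist G u v = 0"
      using p(2) p(3)[of "[]"] u by (simp add: awalk_Nil_iff)
  qed
qed

lemma graph_dist_eq_1_iff:
  assumes G: "simple_connected_graph G" and u: "u \<in> pverts G" and v: "v \<in> pverts G"
  shows "graph_dist G u v = 1 \<longleftrightarrow> (u, v) \<in> parcs G"
proof -
  interpret pair_bidirected_digraph G
    using G by (simp add: simple_connected_graph_def)
  obtain p where p: "awalk u p v" "graph_dist G u v = ereal (real (length p))"
      "\<And>q. awalk u q v \<Longrightarrow> length p \<le> length q"
    using graph_dist_shortest_walk[OF G u v] by blast
  show ?thesis
  proof
    assume "graph_dist G u v = 1"
    then have "length p = 1" 
      using p(2) by simp
    then obtain e where "p = [e]"
      by (auto simp: length_Suc_conv)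
    then show "(u, v) \<in> parcs G"
      using p(1) by (cases e) (auto simp: awalk_simps)
  next
    assume uv: "(u, v) \<in> parcs G"
    then have "length p \<le> 1"
      using p(3)[of "[(u, v)]"] u v by (simp add: awalk_simps)
    moreover have "u \<noteq> v"
      using pair_no_loops[OF uv] by simp
    then have "p \<noteq> []"
      using p(1) by (auto simp: awalk_simps)
    ultimately have "length p = 1"
      by (cases p) auto
    then show "graph_dist G u v = 1"
      using p(2) by simp
  qed
qed

lemma metric_dim_le_iff:
  "metric_dim G \<le> enat k \<longleftrightarrow> (\<exists>S. resolving_set G S \<and> finite S \<and> card S \<le> k)"
proof
  assume "metric_dim G \<le> enat k"
  \<comment> \<open>A strict bound on an infimum is met by one of its members.\<close>
  then have "metric_dim G < enat (Suc k)"
    using le_less_trans by fastforce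
  then show "\<exists>S. resolving_set G S \<and> finite S \<and> card S \<le> k"
    by (auto simp: metric_dim_def INF_less_iff less_Suc_eq_le)
next
  assume "\<exists>S. resolving_set G S \<and> finite S \<and> card S \<le> k"
  then show "metric_dim G \<le> enat k"
    by (auto simp: metric_dim_def intro: INF_lower2)
qed

section \<open>Complete subgraphs have at most \<open>2 ^ k\<close> vertices\<close>

lemma contains_complete_iff:
  assumes "simple_connected_graph G"
  shows "contains_complete G n \<longleftrightarrow>
    (\<exists>W. W \<subseteq> pverts G \<and> finite W \<and> card W = n \<and> (\<forall>u\<in>W. \<forall>v\<in>W. u \<noteq> v \<longrightarrow> (u, v) \<in> parcs G))"
    (is "?L \<longleftrightarrow> ?R")
proof
  assume ?L
  then obtain H :: "'a pair_pre_digraph"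
    where sub: "subgraph (with_proj H) (with_proj G)" and comp: "complete_digraph n (with_proj H)"
    by (auto simp: contains_complete_def)
  then show ?R
    by (intro exI[of _ "pverts H"]) (auto simp: subgraph_def complete_digraph_pair_def)
next
  assume ?R
  then obtain W where W: "W \<subseteq> pverts G" "finite W" "card W = n"
      "\<forall>u\<in>W. \<forall>v\<in>W. u \<noteq> v \<longrightarrow> (u, v) \<in> parcs G"
    by blast
  interpret pair_bidirected_digraph G
    using assms by (simp add: simple_connected_graph_def)
  define H where "H = \<lparr>pverts = W, parcs = {(u, v). u \<in> W \<and> v \<in> W \<and> u \<noteq> v}\<rparr>"
  have wf: "wf_digraph (with_proj H)"
    unfolding wf_digraph_wp_iff by unfold_locales (auto simp: H_def)
  have "subgraph (with_proj H) (with_proj G)"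
    using W wf wf_digraph_axioms by (auto simp: subgraph_def H_def)
  moreover have "complete_digraph n (with_proj H)"
    using W by (auto simp: complete_digraph_pair_def H_def)
  ultimately show ?L
    by (auto simp: contains_complete_def)
qed

text \<open>
  Knowing the set \<open>nearest w\<close> amounts to knowing all distances from \<open>w\<close> to the landmarks, since each
  of them is one of two consecutive numbers. The landmarks resolve the graph, so \<open>nearest\<close> embeds the
  vertices of the complete subgraph into the power set of \<open>S\<close>.
\<close>

lemma complete_subgraph_size_le:
  assumes G: "simple_connected_graph G" and dim: "metric_dim G \<le> enat k"
    and comp: "contains_complete G n"
  shows "n \<le> 2 ^ k"
proof -
  obtain S where S: "resolving_set G S" "finite S" "card S \<le> k"
    using dim by (auto simp: metric_dim_le_iff)
  obtain W where W: "W \<subseteq> pverts G" "finite W" "card W = n"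
      and adj: "\<And>u v. u \<in> W \<Longrightarrow> v \<in> W \<Longrightarrow> u \<noteq> v \<Longrightarrow> (u, v) \<in> parcs G"
    using comp unfolding contains_complete_iff[OF G] by blast
  have SG: "S \<subseteq> pverts G"
    using S(1) by (simp add: resolving_set_def)
  define m where "m s = Min ((\<lambda>w. hops G w s) ` W)" for s
  have m_le: "m s \<le> hops G w s" if "w \<in> W" for w s
    using W(2) that by (simp add: m_def)
  have le_m: "hops G w s \<le> Suc (m s)" if w: "w \<in> W" and s: "s \<in> S" for w s
  proof -
    have "m s \<in> (\<lambda>w. hops G w s) ` W"
      unfolding m_def using W(2) w by (intro Min_in) auto
    then obtain x where x: "x \<in> W" "m s = hops G x s"
      by auto
    show ?thesis
      using x w s SG hops_le_Suc_adjacent[OF G adj[OF w x(1)], of s] by (cases "w = x") auto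
  qed
  define nearest where "nearest w = {s \<in> S. hops G w s = m s}" for w
  have "inj_on nearest W"
  proof (rule inj_onI)
    fix u v
    assume u: "u \<in> W" and v: "v \<in> W" and eq: "nearest u = nearest v"
    have "graph_dist G u s = graph_dist G v s" if s: "s \<in> S" for s
    proof -
      have "hops G u s = m s \<longleftrightarrow> hops G v s = m s"
        using eq s by (auto simp: nearest_def)
      then have "hops G u s = hops G v s"
        using m_le[OF u, of s] m_le[OF v, of s] le_m[OF u s] le_m[OF v s] by linarith
      then show ?thesis
        using graph_dist_eq_hops[OF G] u v s W(1) SG by (simp add: subset_iff)
    qed
    moreover have "u \<in> pverts G" "v \<in> pverts G"
      using u v W(1) by auto
    ultimately show "u = v"
      using S(1) unfolding resolving_set_def by blast
  qed
  then have "card W \<le> card (Pow S)"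
    using S(2) by (intro card_inj_on_le[of nearest]) (auto simp: nearest_def)
  also have "\<dots> \<le> 2 ^ k"
    using S(2,3) by (simp add: card_Pow)
  finally show ?thesis
    using W(3) by simp
qed

section \<open>A finite graph with a complete subgraph on \<open>2 ^ k\<close> vertices\<close>

text \<open>
  A vertex of \<open>S\<close> is the only one at distance 0 from itself, and the vertices at distance 1 from it
  are its neighbours. So the distances to \<open>S\<close> determine a vertex as soon as the neighbourhoods
  within \<open>S\<close> of the vertices outside \<open>S\<close> are distinct.
\<close>

lemma resolving_set_if_neighbours_distinct:
  assumes G: "simple_connected_graph G" and S: "S \<subseteq> pverts G"
    and inj: "inj_on (\<lambda>u. {s \<in> S. (u, s) \<in> parcs G}) (pverts G - S)"
  shows "resolving_set G S"
proof -
  have "u = v" if u: "u \<in> pverts G" and v: "v \<in> pverts G"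
    and eq: "\<And>s. s \<in> S \<Longrightarrow> graph_dist G u s = graph_dist G v s" for u v
  proof (cases "u \<in> S \<or> v \<in> S")
    case True
    then show ?thesis
      using eq[of u] eq[of v] graph_dist_eq_0_iff[OF G u u] graph_dist_eq_0_iff[OF G u v]
        graph_dist_eq_0_iff[OF G v u] graph_dist_eq_0_iff[OF G v v] by auto
  next
    case False
    have "(u, s) \<in> parcs G \<longleftrightarrow> (v, s) \<in> parcs G" if "s \<in> S" for s
      using eq[OF that] that S graph_dist_eq_1_iff[OF G u, of s] graph_dist_eq_1_iff[OF G v, of s]
      by auto
    then have "{s \<in> S. (u, s) \<in> parcs G} = {s \<in> S. (v, s) \<in> parcs G}"
      by auto
    then show ?thesis
      using inj u v False by (auto dest: inj_onD)
  qed
  then show ?thesis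
    using S by (auto simp: resolving_set_def)
qed

lemma simple_connected_graph_if_universal_vertex:
  assumes G: "pair_bidirected_digraph G" and t: "t \<in> pverts G"
    and adj: "\<And>u. u \<in> pverts G \<Longrightarrow> u \<noteq> t \<Longrightarrow> (u, t) \<in> parcs G"
  shows "simple_connected_graph G"
proof -
  interpret pair_bidirected_digraph G by fact
  have to: "u \<rightarrow>\<^sup>*\<^bsub>with_proj G\<^esub> t" if "u \<in> pverts G" for u
    using adj[OF that] that by (cases "u = t") auto
  have from_t: "t \<rightarrow>\<^sup>*\<^bsub>with_proj G\<^esub> u" if "u \<in> pverts G" for u
    using arcs_symmetric[OF adj[OF that]] that by (cases "u = t") auto
  have "u \<rightarrow>\<^sup>*\<^bsub>with_proj G\<^esub> v" if "u \<in> pverts G" "v \<in> pverts G" for u v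
    using to[OF that(1)] from_t[OF that(2)] by (rule reachable_trans)
  then have "Digraph_Component.connected (with_proj G)"
    unfolding Digraph_Component.connected_def
    using t by (intro strongly_connectedI) (auto intro: reachable_mk_symmetricI)
  then show ?thesis
    using G by (simp add: simple_connected_graph_def)
qed

text \<open>
  The bijection \<open>h\<close> makes every pattern of adjacencies to \<open>S\<close> occur exactly once in \<open>C\<close>: at most
  once, so that \<open>S\<close> resolves the graph, and the full pattern at least once, so that the graph is
  connected. Both \<open>S\<close> and \<open>C\<close> are taken from the given infinite type, where \<open>h\<close> exists because the
  cardinalities agree.
\<close>

lemma ex_graph_with_large_complete_subgraph:
  "\<exists>G :: ('a :: infinite) pair_pre_digraph. finite (pverts G) \<and>
     simple_connected_graph G \<and> metric_dim G \<le> enat k \<and> contains_complete G (2 ^ k)"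
proof -
  obtain S :: "'a set" where S: "finite S" "card S = k"
    using infinite_arbitrarily_large[OF infinite_UNIV] by blast
  have "infinite (- S)"
    using S(1) infinite_UNIV by (simp add: Compl_eq_Diff_UNIV)
  then obtain C where C: "finite C" "card C = 2 ^ k" "C \<subseteq> - S"
    using infinite_arbitrarily_large by metis
  have "card C = card (Pow S)"
    using C(2) S by (simp add: card_Pow)
  then obtain h where h: "bij_betw h C (Pow S)"
    using C(1) S(1) by (metis finite_Pow_iff finite_same_card_bij)
  then obtain t where t: "t \<in> C" "h t = S"
    by (metis Pow_top bij_betw_iff_bijections)
  have hS: "s \<in> S" if "u \<in> C" "s \<in> h u" for u s
    using h that by (auto simp: bij_betw_def)
  define G where "G = \<lparr>pverts = C \<union> S, parcs = {(u, v). u \<noteq> v \<and>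
    (u \<in> C \<and> v \<in> C \<or> u \<in> C \<and> v \<in> h u \<or> v \<in> C \<and> u \<in> h v)}\<rparr>"
  have bid: "pair_bidirected_digraph G"
    by unfold_locales (use hS in \<open>auto simp: G_def symmetric_def sym_def\<close>)
  have G: "simple_connected_graph G"
    using t by (intro simple_connected_graph_if_universal_vertex[OF bid, of t]) (auto simp: G_def)
  have nbrs: "{s \<in> S. (u, s) \<in> parcs G} = h u" if "u \<in> C" for u
    using that hS C(3) by (auto simp: G_def)
  have "pverts G - S = C"
    using C(3) by (auto simp: G_def)
  then have "inj_on (\<lambda>u. {s \<in> S. (u, s) \<in> parcs G}) (pverts G - S)"
    using h nbrs by (auto simp: bij_betw_def inj_on_def)
  then have "resolving_set G S"
    by (intro resolving_set_if_neighbours_distinct[OF G]) (auto simp: G_def)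
  then have "metric_dim G \<le> enat k"
    using S by (auto simp: metric_dim_le_iff)
  moreover have "contains_complete G (2 ^ k)"
    unfolding contains_complete_iff[OF G]
    using C by (intro exI[of _ C]) (auto simp: G_def)
  moreover have "finite (pverts G)"
    using C S by (simp add: G_def)
  ultimately show ?thesis
    using G by blast
qed

theorem theorem3p1:
  fixes k :: nat
  assumes "k \<ge> 1"
  shows "is_maximum
           {n. \<exists>G :: ('a :: infinite) pair_pre_digraph.
                 simple_connected_graph G \<and> metric_dim G \<le> enat k \<and> contains_complete G n}
           (2 ^ k)
       \<and> is_maximum
           {n. \<exists>G :: 'a pair_pre_digraph. finite (pverts G) \<and>
                 simple_connected_graph G \<and> metric_dim G \<le> enat k \<and> contains_complete G n}
           (2 ^ k)"
  using ex_graph_with_large_complete_subgraph[where 'a = 'a, of k] complete_subgraph_size_le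
  unfolding is_maximum_def by blast

end
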